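(* Consider the Bradley-Terry-Luce model on the random bipartite graphs $\mathcal B(n,m,d_{n,m})$, $n\le m$, with merit vectors $\boldsymbol u=\boldsymbol u^{(n,m)}\in\mathbb R^{n+m}$, and let $\alpha_{n,m}=\max_{1\le i,j\le n+m}(u_i-u_j)$. If $$\frac{\exp(\alpha_{n,m})\,(n+m)\log(n+m)}{n\,d_{n,m}}\to 0\qquad (n,m\to\infty),$$ then $$\Pr[\text{Condition A is satisfied}]\to 1\qquad (n,m\to\infty).$$
   Context: Random graph: $L=\{1,\dots,n\}$, $R=\{n+1,\dots,n+m\}$, $n\le m$, $1\le d_{n,m}\le m$. A graph $G\sim\mathcal B(n,m,d_{n,m})$ is the bipartite graph on $L\cup R$ obtained by choosing, independently for each $i\in L$, a uniformly random $d_{n,m}$-element subset of $R$ as the set of neighbours of $i$. Model: $\boldsymbol u=(u_1,\dots,u_{n+m})$ is a deterministic real vector (depending on $(n,m)$) and $f(x)=1/(1+\exp(-x))$. Given $G$, independently for each edge $\{i,j\}$ of $G$, subject $i$ beats subject $j$ with probability $f(u_i-u_j)$ and otherwise $j$ beats $i$. The exam result graph $G'$ is the directed graph on $L\cup R$ with an edge $i\to j$ exactly when $\{i,j\}$ is an edge of $G$ and $i$ beats $j$. Condition A: for every ordered pair $(V_1,V_2)$ of nonempty sets that form a partition of $L\cup R$, there is an edge of $G'$ from $V_1$ to $V_2$ (equivalently, $G'$ is strongly connected). Limits "$n,m\to\infty$" are taken along a given sequence of pairs $(n,m)$ with $n\le m$ and both $n$ and $m$ tending to infinity. Probability is over both $G$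 and the comparison outcomes. *)

theory Defs
  imports "HOL-Probability.Probability"
begin

text \<open>
  The vertices are \<open>L = {1..n}\<close> and \<open>R = {n+1..n+m}\<close>. An undirected edge between \<open>i \<in> L\<close> and
  \<open>j \<in> R\<close> is represented by the single pair \<open>(i, j)\<close>, with the endpoint in \<open>L\<close> first.
\<close>

definition left_vertices :: "nat \<Rightarrow> nat set" where
  "left_vertices n = {1..n}"

definition right_vertices :: "nat \<Rightarrow> nat \<Rightarrow> nat set" where
  "right_vertices n m = {n+1..n+m}"

definition vertices :: "nat \<Rightarrow> nat \<Rightarrow> nat set" where
  "vertices n m = left_vertices n \<union> right_vertices n m"

definition random_bipartite :: "nat \<Rightarrow> nat \<Rightarrow> nat \<Rightarrow> (nat \<times> nat) set pmf" where
  "random_bipartite n m d =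
     map_pmf (\<lambda>N. SIGMA i:left_vertices n. N i)
       (Pi_pmf (left_vertices n) {}
          (\<lambda>i. pmf_of_set {S. S \<subseteq> right_vertices n m \<and> card S = d}))"

definition logistic :: "real \<Rightarrow> real" where
  "logistic x = 1 / (1 + exp (- x))"

text \<open>
  For an edge \<open>(i, j)\<close>, the outcome \<open>True\<close> means that \<open>i\<close> beats \<open>j\<close>, and \<open>False\<close> that \<open>j\<close> beats \<open>i\<close>.
\<close>

definition comparison_outcomes ::
    "(nat \<Rightarrow> real) \<Rightarrow> (nat \<times> nat) set \<Rightarrow> (nat \<times> nat \<Rightarrow> bool) pmf" where
  "comparison_outcomes u E =
     Pi_pmf E False (\<lambda>(i, j). bernoulli_pmf (logistic (u i - u j)))"

definition result_edges ::
    "(nat \<times> nat) set \<Rightarrow> (nat \<times> nat \<Rightarrow> bool) \<Rightarrow> (nat \<times> nat) set" where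
  "result_edges E w =
     {(i, j). (i, j) \<in> E \<and> w (i, j)} \<union> {(j, i) |i j. (i, j) \<in> E \<and> \<not> w (i, j)}"

definition exam_result_graph ::
    "nat \<Rightarrow> nat \<Rightarrow> nat \<Rightarrow> (nat \<Rightarrow> real) \<Rightarrow> (nat \<times> nat) set pmf" where
  "exam_result_graph n m d u =
     bind_pmf (random_bipartite n m d)
       (\<lambda>E. map_pmf (result_edges E) (comparison_outcomes u E))"

definition condition_A :: "nat \<Rightarrow> nat \<Rightarrow> (nat \<times> nat) set \<Rightarrow> bool" where
  "condition_A n m D \<longleftrightarrow>
     (\<forall>V1 V2. V1 \<noteq> {} \<and> V2 \<noteq> {} \<and> V1 \<union> V2 = vertices n m \<and> V1 \<inter> V2 = {} \<longrightarrow>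
        (\<exists>i\<in>V1. \<exists>j\<in>V2. (i, j) \<in> D))"

text \<open>Only the coordinates \<open>u i\<close> with \<open>i \<in> vertices n m\<close> are ever used.\<close>

definition merit_spread :: "nat \<Rightarrow> nat \<Rightarrow> (nat \<Rightarrow> real) \<Rightarrow> real" where
  "merit_spread n m u = Max {u i - u j |i j. i \<in> vertices n m \<and> j \<in> vertices n m}"

end

theory Submission
  imports Defs "HOL-Real_Asymp.Real_Asymp"
begin

text \<open>
  Union bound over the cuts. For \<open>V\<close> meeting \<open>L\<close> in \<open>a\<close> and \<open>R\<close> in \<open>b\<close> vertices, there are
  \<open>K = a (m - b) + (n - a) b\<close> pairs in \<open>L \<times> R\<close> separated by \<open>V\<close>. Every edge of \<open>G\<close> among
  them points out of \<open>V\<close> with probability at least \<open>q = exp (- \<alpha>) / 2\<close>, and averaging over \<open>G\<close>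
  shows that none does with probability at most \<open>(1 - q d / m) ^ K \<le> exp (- q d K / m)\<close>.
  Since \<open>2 K \<ge> n (min a (n - a) + min b (m - b))\<close>, this is at most \<open>z ^ card (sym_diff V C)\<close>
  for one of \<open>C = {}, L, R, L \<union> R\<close>, where \<open>z = exp (- q d n / (2 m))\<close>. Summing over \<open>V\<close>
  gives at most \<open>4 ((1 + z) ^ (n + m) - 1) + 2 z\<close>, the last term coming from the cuts
  \<open>V = L, R\<close>; the hypothesis forces \<open>z \<le> 1 / (n + m)\<^sup>2\<close> eventually.
\<close>

section \<open>Uniform \<open>d\<close>-subsets and thinning\<close>

text \<open>The ratio of the two binomials is the chance that a uniform \<open>d\<close>-subset of
  \<open>N\<close> points avoids \<open>t\<close> given ones. Deleting these points one at a time
  multiplies it by factors \<open>(a - d) / a\<close> with \<open>a \<le> N\<close>, each at most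
  \<open>1 - d / N\<close>.\<close>

lemma binomial_diff_le:
  assumes "d \<le> N" "t \<le> N"
  shows "real ((N - t) choose d) \<le> (1 - real d / real N) ^ t * real (N choose d)"
  using assms(2)
proof (induction t)
  case 0
  then show ?case by simp
next
  case (Suc t)
  define a where "a = N - t"
  have a: "a \<ge> 1" "N - Suc t = a - 1" "a \<le> N" using Suc.prems by (auto simp: a_def)
  have rec: "real (a - d) * real (a choose d) = real a * real ((a - 1) choose d)"
    using binomial_absorb_comp[of a d] by (metis of_nat_mult)
  \<comment> \<open>Natural subtraction truncates: for \<open>d > a\<close> the left side is 0, and
    \<open>d \<le> N\<close> keeps the right side nonnegative.\<close>
  have "real (a - d) / real a \<le> 1 - real d / real N"
  proof (cases "d \<le> a")
    case True
    have "real d / real N \<le> real d / real a"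
      using a by (intro divide_left_mono) auto
    then show ?thesis using True a by (simp add: of_nat_diff diff_divide_distrib)
  next
    case False
    then show ?thesis using assms(1) a by simp
  qed
  moreover have "real ((N - Suc t) choose d) = real (a - d) / real a * real (a choose d)"
    using rec a by (simp add: field_simps)
  ultimately have "real ((N - Suc t) choose d) \<le> (1 - real d / real N) * real (a choose d)"
    by (metis mult_right_mono of_nat_0_le_iff)
  also have "\<dots> \<le> (1 - real d / real N) * ((1 - real d / real N) ^ t * real (N choose d))"
    using Suc assms(1) by (intro mult_left_mono) (auto simp: a_def divide_le_eq)
  finally show ?case by simp
qed

text \<open>
  Thinning: expanding each factor \<open>1 - q \<cdot> [t \<in> S]\<close> as \<open>q \<cdot> [t \<notin> S] + (1 - q)\<close>
  reduces the sum to counting the sets \<open>S\<close> that avoid a given \<open>U \<subseteq> T\<close>.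
\<close>

lemma sum_subsets_power_card_Int_le:
  fixes q :: real
  assumes "finite R" "T \<subseteq> R" "d \<le> card R" "0 \<le> q" "q \<le> 1"
  shows "(\<Sum>S | S \<subseteq> R \<and> card S = d. (1 - q) ^ card (S \<inter> T))
           \<le> (1 - q * d / card R) ^ card T * (card R choose d)"
proof -
  let ?F = "{S. S \<subseteq> R \<and> card S = d}"
  let ?r = "1 - real d / card R"
  have finT: "finite T" using assms finite_subset by blast
  have finF: "finite ?F" using assms(1) by auto
  have expand: "(1 - q) ^ card (S \<inter> T)
      = (\<Sum>U\<in>Pow T. (if S \<inter> U = {} then q ^ card U * (1 - q) ^ card (T - U) else 0))" for S
  proof -
    have "(1 - q) ^ card (S \<inter> T) = (\<Prod>t\<in>T. (if t \<in> S then 0 else q) + (1 - q))"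
    proof -
      have "(\<Prod>t\<in>T. (if t \<in> S then 0 else q) + (1 - q)) = (\<Prod>t\<in>T. if t \<in> S then 1 - q else 1)"
        by (rule prod.cong) auto
      also have "\<dots> = (1 - q) ^ card (T \<inter> S)"
        using finT by (simp add: prod.inter_restrict[symmetric])
      finally show ?thesis by (simp add: Int_commute)
    qed
    also have "\<dots> = (\<Sum>U\<in>Pow T. (\<Prod>t\<in>U. if t \<in> S then 0 else q) * (\<Prod>t\<in>T - U. 1 - q))"
      using finT by (rule prod_add)
    also have "\<dots> = (\<Sum>U\<in>Pow T. (if S \<inter> U = {} then q ^ card U * (1 - q) ^ card (T - U) else 0))"
    proof (rule sum.cong)
      fix U assume "U \<in> Pow T"
      then have "finite U" using finT finite_subset by auto
      then show "(\<Prod>t\<in>U. if t \<in> S then 0 else q) * (\<Prod>t\<in>T - U. 1 - q)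
          = (if S \<inter> U = {} then q ^ card U * (1 - q) ^ card (T - U) else 0)"
      proof (cases "S \<inter> U = {}")
        case True
        then have "(\<Prod>t\<in>U. if t \<in> S then 0 else q) = (\<Prod>t\<in>U. q)"
          by (intro prod.cong) auto
        then show ?thesis using True by simp
      next
        case False
        then show ?thesis using \<open>finite U\<close> by (auto intro!: prod_zero)
      qed
    qed simp
    finally show ?thesis .
  qed
  have count: "card {S \<in> ?F. S \<inter> U = {}} = (card R - card U) choose d" if "U \<subseteq> T" for U
  proof -
    have "{S \<in> ?F. S \<inter> U = {}} = {S. S \<subseteq> R - U \<and> card S = d}" by auto
    moreover have "card (R - U) = card R - card U"
      using that assms finite_subset[of U R] by (intro card_Diff_subset) auto
    ultimately show ?thesis using assms(1) by (simp add: n_subsets)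
  qed
  have "(\<Sum>S\<in>?F. (1 - q) ^ card (S \<inter> T))
      = (\<Sum>U\<in>Pow T. \<Sum>S\<in>?F. (if S \<inter> U = {} then q ^ card U * (1 - q) ^ card (T - U) else 0))"
    unfolding expand by (rule sum.swap)
  also have "\<dots> = (\<Sum>U\<in>Pow T. q ^ card U * (1 - q) ^ card (T - U) * ((card R - card U) choose d))"
  proof (rule sum.cong)
    fix U assume U: "U \<in> Pow T"
    have "(\<Sum>S\<in>?F. (if S \<inter> U = {} then q ^ card U * (1 - q) ^ card (T - U) else 0))
        = (\<Sum>S\<in>{S \<in> ?F. S \<inter> U = {}}. q ^ card U * (1 - q) ^ card (T - U))"
      using finF by (subst sum.inter_filter) auto
    then show "(\<Sum>S\<in>?F. (if S \<inter> U = {} then q ^ card U * (1 - q) ^ card (T - U) else 0))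
        = q ^ card U * (1 - q) ^ card (T - U) * ((card R - card U) choose d)"
      using count[of U] U by simp
  qed simp
  also have "\<dots> \<le> (\<Sum>U\<in>Pow T. q ^ card U * (1 - q) ^ card (T - U) * (?r ^ card U * (card R choose d)))"
  proof (rule sum_mono)
    fix U assume U: "U \<in> Pow T"
    then have "card U \<le> card R" using assms by (intro card_mono) auto
    from binomial_diff_le[OF assms(3) this]
    show "q ^ card U * (1 - q) ^ card (T - U) * ((card R - card U) choose d)
        \<le> q ^ card U * (1 - q) ^ card (T - U) * (?r ^ card U * (card R choose d))"
      using assms by (intro mult_left_mono) auto
  qed
  \<comment> \<open>The expansion is now read backwards, with summands \<open>q * ?r\<close> and
    \<open>1 - q\<close>, so that the sum over \<open>U\<close> folds into a single power.\<close>
  also have "\<dots> = (\<Sum>U\<in>Pow T. (\<Prod>t\<in>U. q * ?r) * (\<Prod>t\<in>T - U. 1 - q)) * (card R choose d)"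
    by (simp add: sum_distrib_left sum_distrib_right power_mult_distrib mult_ac)
  also have "(\<Sum>U\<in>Pow T. (\<Prod>t\<in>U. q * ?r) * (\<Prod>t\<in>T - U. 1 - q)) = (q * ?r + (1 - q)) ^ card T"
    using prod_add[OF finT, of "\<lambda>_. q * ?r" "\<lambda>_. 1 - q"] by simp
  also have "q * ?r + (1 - q) = 1 - q * d / card R" by (simp add: algebra_simps)
  finally show ?thesis .
qed

section \<open>Probability that no result edge leaves a fixed vertex set\<close>

text \<open>The bad events of the union bound: condition A fails exactly when \<open>D\<close> lies
  in one of these sets for a nonempty proper subset \<open>V\<close> of the vertices.\<close>

definition no_edge_out_of :: "nat \<Rightarrow> nat \<Rightarrow> nat set \<Rightarrow> (nat \<times> nat) set set" where
  "no_edge_out_of n m V = {D. \<forall>i\<in>V. \<forall>j\<in>vertices n m - V. (i, j) \<notin> D}"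

lemma logistic_uminus: "logistic (- x) = 1 - logistic x"
proof -
  have "1 + exp x \<noteq> 0" by (metis add_pos_pos exp_gt_zero less_irrefl zero_less_one)
  then show ?thesis unfolding logistic_def
    by (simp add: divide_simps exp_minus)
qed

lemma logistic_bounds: "0 \<le> logistic x" "logistic x \<le> 1"
  by (auto simp: logistic_def add_nonneg_nonneg add_pos_nonneg divide_simps)

lemma logistic_mono: "x \<le> y \<Longrightarrow> logistic x \<le> logistic y"
  unfolding logistic_def by (intro divide_left_mono) (auto intro!: mult_pos_pos add_pos_pos)

lemma finite_vertices [simp]: "finite (vertices n m)"
  by (simp add: vertices_def left_vertices_def right_vertices_def)

lemma merit_spread_ge:
  assumes "i \<in> vertices n m" "j \<in> vertices n m"
  shows "u i - u j \<le> merit_spread n m u"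
proof -
  have "{u i - u j |i j. i \<in> vertices n m \<and> j \<in> vertices n m}
      = (\<lambda>(i, j). u i - u j) ` (vertices n m \<times> vertices n m)" by auto
  then have "finite {u i - u j |i j. i \<in> vertices n m \<and> j \<in> vertices n m}" by simp
  then show ?thesis unfolding merit_spread_def using assms by (intro Max_ge) auto
qed

text \<open>Each edge crossing the cut has to be won by its endpoint outside \<open>V\<close>. The
  other endpoint wins with probability at least \<open>q\<close>, since its merit deficit is at most
  the spread, and the outcomes are independent.\<close>

lemma prob_no_edge_out_of_given_graph:
  assumes E: "E \<subseteq> vertices n m \<times> vertices n m"
    and q: "0 \<le> q" "q \<le> logistic (- merit_spread n m u)"
  shows "measure_pmf.prob (map_pmf (result_edges E) (comparison_outcomes u E)) (no_edge_out_of n m V)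
           \<le> (\<Prod>(i, j)\<in>E. if (i \<in> V) \<noteq> (j \<in> V) then 1 - q else 1)"
proof -
  have finE: "finite E" using E by (rule finite_subset) simp
  \<comment> \<open>\<open>B e\<close> holds the outcomes of \<open>e\<close> that create no edge
    out of \<open>V\<close>; this puts the event inside a product set, whose probability
    factorises.\<close>
  define B where "B = (\<lambda>e::nat \<times> nat. {b. (fst e \<in> V \<and> snd e \<notin> V \<longrightarrow> \<not> b) \<and> (fst e \<notin> V \<and> snd e \<in> V \<longrightarrow> b)})"
  have "result_edges E -` no_edge_out_of n m V \<subseteq> Pi E B"
  proof
    fix w assume "w \<in> result_edges E -` no_edge_out_of n m V"
    then have *: "\<And>i j. i \<in> V \<Longrightarrow> j \<in> vertices n m \<Longrightarrow> j \<notin> V \<Longrightarrow> (i, j) \<notin> result_edges E w"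
      by (auto simp: no_edge_out_of_def)
    show "w \<in> Pi E B"
    proof
      fix e assume e: "e \<in> E"
      then show "w e \<in> B e"
        using E *[of "fst e" "snd e"] *[of "snd e" "fst e"]
        by (cases e) (auto simp: B_def result_edges_def)
    qed
  qed
  then have "measure_pmf.prob (map_pmf (result_edges E) (comparison_outcomes u E)) (no_edge_out_of n m V)
      \<le> measure_pmf.prob (comparison_outcomes u E) (Pi E B)"
    by (simp add: measure_pmf.finite_measure_mono)
  also have "\<dots> = (\<Prod>e\<in>E. measure_pmf.prob (case e of (i, j) \<Rightarrow> bernoulli_pmf (logistic (u i - u j))) (B e))"
    unfolding comparison_outcomes_def using finE by (rule measure_Pi_pmf_Pi)
  also have "\<dots> \<le> (\<Prod>e\<in>E. case e of (i, j) \<Rightarrow> if (i \<in> V) \<noteq> (j \<in> V) then 1 - q else 1)"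
  proof (rule prod_mono)
    fix e assume e: "e \<in> E"
    obtain i j where ij: "e = (i, j)" by fastforce
    let ?p = "bernoulli_pmf (logistic (u i - u j))"
    have v: "i \<in> vertices n m" "j \<in> vertices n m" using e ij E by auto
    \<comment> \<open>The endpoint inside \<open>V\<close> may be the first or the second coordinate
      of the edge; the two bounds serve these two cases.\<close>
    have 1: "q \<le> logistic (u i - u j)"
      using merit_spread_ge[OF v(2,1), of u] q(2) logistic_mono[of "- merit_spread n m u" "u i - u j"] by linarith
    have 2: "q \<le> 1 - logistic (u i - u j)"
      using merit_spread_ge[OF v, of u] q(2) logistic_mono[of "- merit_spread n m u" "u j - u i"]
        logistic_uminus[of "u i - u j"] by simp
    consider (out) "i \<in> V" "j \<notin> V" | (into) "i \<notin> V" "j \<in> V" | (same) "(i \<in> V) = (j \<in> V)" by blast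
    then have "measure_pmf.prob ?p (B e) \<le> (if (i \<in> V) \<noteq> (j \<in> V) then 1 - q else 1)"
    proof cases
      case out
      then have "B e = {False}" by (auto simp: B_def ij)
      then show ?thesis using out 1 logistic_bounds[of "u i - u j"] by (simp add: measure_pmf_single)
    next
      case into
      then have "B e = {True}" by (auto simp: B_def ij)
      then show ?thesis using into 2 logistic_bounds[of "u i - u j"] by (simp add: measure_pmf_single)
    next
      case same
      then show ?thesis by simp
    qed
    then show "0 \<le> measure_pmf.prob (case e of (i, j) \<Rightarrow> bernoulli_pmf (logistic (u i - u j))) (B e) \<and>
      measure_pmf.prob (case e of (i, j) \<Rightarrow> bernoulli_pmf (logistic (u i - u j))) (B e)
        \<le> (case e of (i, j) \<Rightarrow> if (i \<in> V) \<noteq> (j \<in> V) then 1 - q else 1)"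
      by (simp add: ij)
  qed
  finally show ?thesis .
qed

text \<open>Neighbourhoods of distinct left vertices are independent, so the mean over the graph of
  the conditional bound factorises. The factor of \<open>i\<close> is an average over uniform
  \<open>d\<close>-subsets, bounded by thinning with \<open>T\<close> the right vertices separated
  from \<open>i\<close> by \<open>V\<close>.\<close>

lemma prob_no_edge_out_of_le_prod:
  assumes d: "d \<le> m"
    and q: "0 \<le> q" "q \<le> logistic (- merit_spread n m u)"
  shows "measure_pmf.prob (exam_result_graph n m d u) (no_edge_out_of n m V)
    \<le> (\<Prod>i\<in>left_vertices n. (1 - q * d / m) ^ card {j \<in> right_vertices n m. (i \<in> V) \<noteq> (j \<in> V)})"
proof -
  define T where "T = (\<lambda>i. {j \<in> right_vertices n m. (i \<in> V) \<noteq> (j \<in> V)})"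
  let ?F = "{S. S \<subseteq> right_vertices n m \<and> card S = d}"
  have finR: "finite (right_vertices n m)" and finL: "finite (left_vertices n)"
    and cardR: "card (right_vertices n m) = m"
    by (simp_all add: right_vertices_def left_vertices_def)
  have finF: "finite ?F" using finR by simp
  have cardF: "card ?F = m choose d" using n_subsets[OF finR, of d] cardR by simp
  have pos: "m choose d > 0" using d by simp
  then have F_ne: "?F \<noteq> {}" using cardF by (metis card.empty less_irrefl)
  have q1: "q \<le> 1" using q logistic_bounds(2) order_trans by blast
  have "emeasure (exam_result_graph n m d u) (no_edge_out_of n m V) =
    (\<integral>\<^sup>+N. emeasure (map_pmf (result_edges (SIGMA i:left_vertices n. N i))
       (comparison_outcomes u (SIGMA i:left_vertices n. N i))) (no_edge_out_of n m V)
       \<partial>Pi_pmf (left_vertices n) {} (\<lambda>i. pmf_of_set ?F))"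
    unfolding exam_result_graph_def random_bipartite_def by simp
  also have "\<dots> \<le> (\<integral>\<^sup>+N. (\<Prod>i\<in>left_vertices n. ennreal ((1 - q) ^ card (N i \<inter> T i)))
       \<partial>Pi_pmf (left_vertices n) {} (\<lambda>i. pmf_of_set ?F))"
  \<comment> \<open>The comparison is made on the support only, where every \<open>N i\<close>
    consists of right vertices.\<close>
  proof (intro nn_integral_mono_AE AE_pmfI)
    fix N assume N_supp: "N \<in> set_pmf (Pi_pmf (left_vertices n) {} (\<lambda>i. pmf_of_set ?F))"
    then have N: "N i \<subseteq> right_vertices n m" if "i \<in> left_vertices n" for i
    proof -
      have "N \<in> PiE_dflt (left_vertices n) {} (set_pmf \<circ> (\<lambda>i. pmf_of_set ?F))"
        by (rule subsetD[OF set_Pi_pmf_subset'[OF finL] N_supp])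
      then have "N i \<in> set_pmf (pmf_of_set ?F)" using that by (auto simp: PiE_dflt_def)
      then show ?thesis using finF F_ne by (simp add: set_pmf_of_set)
    qed
    let ?E = "SIGMA i:left_vertices n. N i"
    have "measure_pmf.prob (map_pmf (result_edges ?E) (comparison_outcomes u ?E)) (no_edge_out_of n m V)
      \<le> (\<Prod>(i, j)\<in>?E. if (i \<in> V) \<noteq> (j \<in> V) then 1 - q else 1)"
      using N q by (intro prob_no_edge_out_of_given_graph) (auto simp: vertices_def)
    also have "\<dots> = (\<Prod>i\<in>left_vertices n. \<Prod>j\<in>N i. if (i \<in> V) \<noteq> (j \<in> V) then 1 - q else 1)"
      using N finR finL by (intro prod.Sigma[symmetric]) (auto intro: finite_subset)
    also have "\<dots> = (\<Prod>i\<in>left_vertices n. (1 - q) ^ card (N i \<inter> T i))"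
    proof (rule prod.cong)
      fix i assume i: "i \<in> left_vertices n"
      then have "finite (N i)" using N finR finite_subset by blast
      then have "(\<Prod>j\<in>N i. if (i \<in> V) \<noteq> (j \<in> V) then 1 - q else 1) = (\<Prod>j\<in>{j \<in> N i. (i \<in> V) \<noteq> (j \<in> V)}. 1 - q)"
        by (rule prod.inter_filter[symmetric])
      moreover have "{j \<in> N i. (i \<in> V) \<noteq> (j \<in> V)} = N i \<inter> T i" using N[OF i] by (auto simp: T_def)
      ultimately show "(\<Prod>j\<in>N i. if (i \<in> V) \<noteq> (j \<in> V) then 1 - q else 1) = (1 - q) ^ card (N i \<inter> T i)" by simp
    qed simp
    finally show "emeasure (map_pmf (result_edges ?E) (comparison_outcomes u ?E)) (no_edge_out_of n m V)
        \<le> (\<Prod>i\<in>left_vertices n. ennreal ((1 - q) ^ card (N i \<inter> T i)))"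
      using q1 by (subst prod_ennreal) (auto simp: measure_pmf.emeasure_eq_measure intro!: ennreal_leI)
  qed
  also have "\<dots> = (\<Prod>i\<in>left_vertices n. \<integral>\<^sup>+S. ennreal ((1 - q) ^ card (S \<inter> T i)) \<partial>pmf_of_set ?F)"
    using finL by (rule nn_integral_prod_Pi_pmf)
  also have "\<dots> \<le> (\<Prod>i\<in>left_vertices n. ennreal ((1 - q * d / m) ^ card (T i)))"
  proof (rule prod_mono_ennreal)
    fix i
    have "(\<integral>\<^sup>+S. ennreal ((1 - q) ^ card (S \<inter> T i)) \<partial>pmf_of_set ?F)
        = ennreal ((\<Sum>S\<in>?F. (1 - q) ^ card (S \<inter> T i)) / card ?F)"
      using finF F_ne q1
      by (simp add: nn_integral_pmf_of_set sum_ennreal divide_ennreal ennreal_of_nat_eq_real_of_nat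
          sum_nonneg card_gt_0_iff)
    also have "\<dots> \<le> ennreal ((1 - q * d / m) ^ card (T i))"
      using sum_subsets_power_card_Int_le[OF finR, of "T i" d q] d q(1) q1 pos
      by (intro ennreal_leI) (simp add: cardR cardF divide_le_eq T_def)
    finally show "(\<integral>\<^sup>+S. ennreal ((1 - q) ^ card (S \<inter> T i)) \<partial>pmf_of_set ?F)
        \<le> ennreal ((1 - q * d / m) ^ card (T i))" .
  qed
  finally show ?thesis
  proof -
    \<comment> \<open>Passing from \<open>ennreal\<close> back to the reals requires a nonnegative
      base.\<close>
    have "q * d \<le> 1 * real m" using q q1 d by (intro mult_mono) auto
    then have "0 \<le> 1 - q * d / m" by (auto simp: divide_le_eq)
    then have *: "0 \<le> (\<Prod>i\<in>left_vertices n. (1 - q * d / m) ^ card (T i))" by (simp add: prod_nonneg)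
    assume "emeasure (exam_result_graph n m d u) (no_edge_out_of n m V)
        \<le> (\<Prod>i\<in>left_vertices n. ennreal ((1 - q * d / m) ^ card (T i)))"
    then show ?thesis
      using * \<open>0 \<le> 1 - q * d / m\<close>
      by (simp add: prod_ennreal measure_pmf.emeasure_eq_measure T_def)
  qed
qed


section \<open>Cut sizes and the union bound\<close>

text \<open>Symmetric difference with \<open>C\<close> is an involution on \<open>Pow W\<close>,
  which reduces the sum to a binomial expansion; the subtracted 1 is the term
  \<open>V = C\<close>.\<close>

lemma sum_power_card_sym_diff:
  fixes z :: real
  assumes "finite W" "C \<subseteq> W"
  shows "(\<Sum>V\<in>Pow W - {C}. z ^ card (sym_diff V C)) = (1 + z) ^ card W - 1"
proof -
  have "(1 + z) ^ card W = (\<Sum>V\<in>Pow W. z ^ card V)"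
    using prod_add[OF assms(1), of "\<lambda>_. z" "\<lambda>_. 1"] by (simp add: add.commute)
  also have "\<dots> = (\<Sum>V\<in>Pow W. z ^ card (sym_diff V C))"
    by (rule sum.reindex_bij_witness[of _ "\<lambda>V. sym_diff V C" "\<lambda>V. sym_diff V C"])
      (use assms in \<open>auto intro!: arg_cong[of _ _ "\<lambda>V. z ^ card V"]\<close>)
  also have "\<dots> = 1 + (\<Sum>V\<in>Pow W - {C}. z ^ card (sym_diff V C))"
    using assms by (subst sum.remove[of _ C]) auto
  finally show ?thesis by simp
qed

text \<open>With \<open>x = n - a\<close> and \<open>y = m - b\<close>, the cut size is
  \<open>a * y + x * b\<close>. One copy of it dominates \<open>(b + y) * min a x\<close>, hence
  \<open>n * min a x\<close> by \<open>n \<le> m\<close>; the other dominates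
  \<open>(a + x) * min b y\<close>.\<close>

lemma cut_size_ge:
  fixes a b n m :: nat
  assumes "a \<le> n" "b \<le> m" "n \<le> m"
  shows "n * (min a (n - a) + min b (m - b)) \<le> 2 * (a * (m - b) + (n - a) * b)"
proof -
  define x y where "x = n - a" and "y = m - b"
  have n: "n = a + x" "m = b + y" using assms by (auto simp: x_def y_def)
  have 1: "m * min a x \<le> a * y + x * b"
    unfolding n add_mult_distrib2
    by (cases "a \<le> x") (auto simp: algebra_simps add_mono mult_le_mono)
  have 2: "n * min b y \<le> a * y + x * b"
    unfolding n
    by (cases "b \<le> y") (auto simp: algebra_simps add_mono mult_le_mono)
  have "n * min a x \<le> m * min a x" using assms(3) by simp
  then show ?thesis using 1 2 unfolding add_mult_distrib2 x_def[symmetric] y_def[symmetric] by linarith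
qed

text \<open>A left vertex in \<open>V\<close> is separated from \<open>m - b\<close> right vertices,
  any other from \<open>b\<close>, so the exponents of the product add up to the cut size; then
  \<open>1 - x \<le> exp (- x)\<close>.\<close>

lemma prob_no_edge_out_of_le_exp:
  assumes d: "1 \<le> d" "d \<le> m"
    and q: "0 \<le> q" "q \<le> logistic (- merit_spread n m u)"
    and V: "V \<subseteq> vertices n m"
  defines "a \<equiv> card (V \<inter> left_vertices n)" and "b \<equiv> card (V \<inter> right_vertices n m)"
  shows "measure_pmf.prob (exam_result_graph n m d u) (no_edge_out_of n m V)
    \<le> exp (- (q * d / m) * real (a * (m - b) + (n - a) * b))"
proof -
  let ?T = "\<lambda>i. {j \<in> right_vertices n m. (i \<in> V) \<noteq> (j \<in> V)}"
  have fin: "finite (left_vertices n)" "finite (right_vertices n m)"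
    and card: "card (left_vertices n) = n" "card (right_vertices n m) = m"
    by (simp_all add: left_vertices_def right_vertices_def)
  have cardT: "card (?T i) = (if i \<in> V then m - b else b)" for i
  proof (cases "i \<in> V")
    case True
    then have "?T i = right_vertices n m - V \<inter> right_vertices n m" by auto
    then show ?thesis using True fin card by (simp add: b_def card_Diff_subset)
  next
    case False
    then have "?T i = V \<inter> right_vertices n m" by auto
    then show ?thesis using False by (simp add: b_def)
  qed
  have "(\<Sum>i\<in>left_vertices n. card (?T i)) = (\<Sum>i\<in>left_vertices n. if i \<in> V then m - b else b)"
    by (simp only: cardT)
  also have "\<dots> = card (left_vertices n \<inter> V) * (m - b) + card (left_vertices n - V) * b"
    using fin by (simp add: sum.If_cases Diff_eq)
  also have "card (left_vertices n - V) = n - a"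
    using fin card by (simp add: a_def card_Diff_subset_Int Int_commute)
  finally have sum: "(\<Sum>i\<in>left_vertices n. card (?T i)) = a * (m - b) + (n - a) * b"
    by (simp add: a_def Int_commute)
  have "q \<le> 1" using q logistic_bounds(2) order_trans by blast
  then have "q * d \<le> 1 * real m" using q d by (intro mult_mono) auto
  then have nonneg: "0 \<le> 1 - q * d / m" by (auto simp: divide_le_eq)
  have "measure_pmf.prob (exam_result_graph n m d u) (no_edge_out_of n m V)
      \<le> (\<Prod>i\<in>left_vertices n. (1 - q * d / m) ^ card (?T i))"
    using d q by (intro prob_no_edge_out_of_le_prod) auto
  also have "\<dots> = (1 - q * d / m) ^ (a * (m - b) + (n - a) * b)"
    unfolding sum[symmetric] by (rule power_sum[symmetric])
  also have "\<dots> \<le> exp (- (q * d / m)) ^ (a * (m - b) + (n - a) * b)"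
    using nonneg exp_ge_add_one_self[of "- (q * d / m)"] by (intro power_mono) auto
  also have "\<dots> = exp (- (q * d / m) * real (a * (m - b) + (n - a) * b))"
    by (simp only: exp_of_nat2_mult)
  finally show ?thesis .
qed

lemma prob_not_condition_A_le:
  assumes d: "1 \<le> d" "d \<le> m"
    and nm: "1 \<le> n" "n \<le> m"
    and q: "0 \<le> q" "q \<le> logistic (- merit_spread n m u)"
  defines "z \<equiv> exp (- (q * d * n / (2 * m)))"
  shows "measure_pmf.prob (exam_result_graph n m d u) {D. \<not> condition_A n m D}
    \<le> 4 * ((1 + z) ^ (n + m) - 1) + 2 * z"
proof -
  let ?L = "left_vertices n" and ?R = "right_vertices n m" and ?W = "vertices n m"
  let ?P = "\<lambda>V. measure_pmf.prob (exam_result_graph n m d u) (no_edge_out_of n m V)"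
  let ?g = "\<lambda>C V. z ^ card (sym_diff V C)"
  let ?s = "\<lambda>C. \<Sum>V\<in>Pow ?W - {C}. ?g C V"
  have fin: "finite ?L" "finite ?R" and W: "?W = ?L \<union> ?R" and LR: "?L \<inter> ?R = {}"
    and card: "card ?L = n" "card ?R = m"
    by (auto simp: left_vertices_def right_vertices_def vertices_def)
  have cardW: "card ?W = n + m" using fin card LR by (simp add: W card_Un_disjoint)
  have z: "0 \<le> z" "z \<le> 1" using q by (auto simp: z_def)
  have c: "0 \<le> q * d / m" using q by simp
  \<comment> \<open>The 2 in the denominator of \<open>z\<close> absorbs the 2 of
    \<open>cut_size_ge\<close>: \<open>z ^ k\<close> is a bound as soon as \<open>n * k\<close> is
    at most twice the cut size.\<close>
  have z_pow: "z ^ k = exp (- (q * d / m) * (n * k / 2))" for k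
    by (simp add: z_def exp_of_nat2_mult[symmetric] mult_ac)
  have P_le: "?P V \<le> z ^ k"
    if V: "V \<subseteq> ?W" and k: "n * k \<le> 2 * (card (V \<inter> ?L) * (m - card (V \<inter> ?R)) + (n - card (V \<inter> ?L)) * card (V \<inter> ?R))"
    for V k
  proof -
    let ?K = "card (V \<inter> ?L) * (m - card (V \<inter> ?R)) + (n - card (V \<inter> ?L)) * card (V \<inter> ?R)"
    have "real (n * k) \<le> real (2 * ?K)" using k by (simp only: of_nat_le_iff)
    then have "n * k / 2 \<le> real ?K" by simp
    then have "q * d / m * (n * k / 2) \<le> q * d / m * real ?K" using c by (rule mult_left_mono)
    then have "exp (- (q * d / m) * real ?K) \<le> z ^ k" by (simp add: z_pow)
    then show ?thesis using prob_no_edge_out_of_le_exp[OF d q V] by linarith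
  qed
  \<comment> \<open>Both cuts separate all \<open>n * m\<close> pairs, so the exponent 1 is
    admissible, whereas the generic bound contains \<open>z ^ 0\<close> for them.\<close>
  have special: "?P ?L \<le> z" "?P ?R \<le> z"
    using P_le[of ?L 1] P_le[of ?R 1] nm LR card by (auto simp: W Int_commute)
  have generic: "?P V \<le> ?g {} V + ?g ?L V + ?g ?R V + ?g ?W V" if V: "V \<subseteq> ?W" for V
  proof -
    define A B where "A = V \<inter> ?L" and "B = V \<inter> ?R"
    have AB: "A \<subseteq> ?L" "B \<subseteq> ?R" "finite A" "finite B" using fin by (auto simp: A_def B_def)
    have le: "card A \<le> n" "card B \<le> m" using AB fin card card_mono by metis+
    have co: "card (?L - A) = n - card A" "card (?R - B) = m - card B"
      using AB card by (simp_all add: card_Diff_subset)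
    have 1: "card (sym_diff V {}) = card A + card B"
    proof -
      have "sym_diff V {} = A \<union> B" using V by (auto simp: A_def B_def W)
      moreover have "A \<inter> B = {}" using AB LR by auto
      ultimately show ?thesis using AB by (simp only: card_Un_disjoint)
    qed
    have 2: "card (sym_diff V ?L) = (n - card A) + card B"
    proof -
      have "sym_diff V ?L = (?L - A) \<union> B" using V LR by (auto simp: A_def B_def W)
      moreover have "(?L - A) \<inter> B = {}" using AB LR by auto
      ultimately show ?thesis using AB fin by (simp only: card_Un_disjoint finite_Diff co)
    qed
    have 3: "card (sym_diff V ?R) = card A + (m - card B)"
    proof -
      have "sym_diff V ?R = A \<union> (?R - B)" using V LR by (auto simp: A_def B_def W)
      moreover have "A \<inter> (?R - B) = {}" using AB LR by auto
      ultimately show ?thesis using AB fin by (simp only: card_Un_disjoint finite_Diff co)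
    qed
    have 4: "card (sym_diff V ?W) = (n - card A) + (m - card B)"
    proof -
      have "sym_diff V ?W = (?L - A) \<union> (?R - B)" using V LR by (auto simp: A_def B_def W)
      moreover have "(?L - A) \<inter> (?R - B) = {}" using AB LR by auto
      ultimately show ?thesis using AB fin by (simp only: card_Un_disjoint finite_Diff co)
    qed
    have "?P V \<le> z ^ (min (card A) (n - card A) + min (card B) (m - card B))"
      using cut_size_ge[OF le nm(2)] unfolding A_def B_def by (rule P_le[OF V])
    \<comment> \<open>The two minima select one of the four distances. Adding the other three
      nonnegative terms makes the bound uniform in \<open>V\<close>.\<close>
    also have "\<dots> \<le> ?g {} V + ?g ?L V + ?g ?R V + ?g ?W V"
    proof -
      have "0 \<le> ?g C V" for C using z by simp
      note this[of "{}"] this[of ?L] this[of ?R] this[of ?W]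
      then show ?thesis unfolding 1 2 3 4 by (auto simp: min_def)
    qed
    finally show ?thesis .
  qed
  have "{D. \<not> condition_A n m D} \<subseteq> (\<Union>V\<in>Pow ?W - {{}, ?W}. no_edge_out_of n m V)"
  proof
    fix D assume "D \<in> {D. \<not> condition_A n m D}"
    then have "\<exists>V1 V2. V1 \<noteq> {} \<and> V2 \<noteq> {} \<and> V1 \<union> V2 = ?W \<and> V1 \<inter> V2 = {} \<and> (\<forall>i\<in>V1. \<forall>j\<in>V2. (i, j) \<notin> D)"
      by (simp add: condition_A_def)
    then obtain V1 V2 where V12: "V1 \<noteq> {}" "V2 \<noteq> {}" "V1 \<union> V2 = ?W" "V1 \<inter> V2 = {}"
      and no: "\<forall>i\<in>V1. \<forall>j\<in>V2. (i, j) \<notin> D"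
      by (elim exE conjE) (rule that)
    have "?W - V1 = V2" using V12(3,4) by auto
    then have "D \<in> no_edge_out_of n m V1" using no by (simp add: no_edge_out_of_def)
    moreover have "V1 \<in> Pow ?W - {{}, ?W}" using V12 by auto
    ultimately show "D \<in> (\<Union>V\<in>Pow ?W - {{}, ?W}. no_edge_out_of n m V)" by (rule UN_I[rotated])
  qed
  then have "measure_pmf.prob (exam_result_graph n m d u) {D. \<not> condition_A n m D}
      \<le> measure_pmf.prob (exam_result_graph n m d u) (\<Union>V\<in>Pow ?W - {{}, ?W}. no_edge_out_of n m V)"
    by (intro measure_pmf.finite_measure_mono) auto
  also have "\<dots> \<le> (\<Sum>V\<in>Pow ?W - {{}, ?W}. ?P V)"
    by (intro measure_pmf.finite_measure_subadditive_finite) auto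
  also have "\<dots> \<le> (\<Sum>V\<in>(Pow ?W - {{}, ?W, ?L, ?R}) \<union> {?L, ?R}. ?P V)"
    by (intro sum_mono2) auto
  also have "\<dots> = (\<Sum>V\<in>Pow ?W - {{}, ?W, ?L, ?R}. ?P V) + (\<Sum>V\<in>{?L, ?R}. ?P V)"
    by (intro sum.union_disjoint) auto
  also have "(\<Sum>V\<in>{?L, ?R}. ?P V) \<le> 2 * z"
    using special z LR nm card by (cases "?L = ?R") auto
  also have "(\<Sum>V\<in>Pow ?W - {{}, ?W, ?L, ?R}. ?P V)
      \<le> (\<Sum>V\<in>Pow ?W - {{}, ?W, ?L, ?R}. ?g {} V + ?g ?L V + ?g ?R V + ?g ?W V)"
    using generic by (intro sum_mono) auto
  \<comment> \<open>The index set omits all four centres, so each of the four sums may be enlarged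
    to omit only its own.\<close>
  also have "\<dots> \<le> ?s {} + ?s ?L + ?s ?R + ?s ?W"
    unfolding sum.distrib using z by (intro add_mono sum_mono2) auto
  also have "\<dots> = 4 * ((1 + z) ^ (n + m) - 1)"
  proof -
    have "?s C = (1 + z) ^ (n + m) - 1" if "C \<subseteq> ?W" for C
      using sum_power_card_sym_diff[OF finite_vertices that] cardW by simp
    from this[of "{}"] this[of ?L] this[of ?R] this[of ?W] show ?thesis by (simp add: W)
  qed
  finally show ?thesis by simp
qed

section \<open>Explicit error bound and the limit\<close>

text \<open>The threshold \<open>1 / 8\<close> is chosen to give
  \<open>z \<le> 1 / N\<^sup>2\<close>: one factor 2 comes from this exponent, one from
  \<open>q\<close>, one from the denominator in \<open>z\<close>.\<close>

lemma prob_not_condition_A_le_of_ratio: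
  assumes d: "1 \<le> d" "d \<le> m"
    and nm: "1 \<le> n" "n \<le> m"
    and ratio: "exp (merit_spread n m u) * real (n + m) * ln (real (n + m)) / (real n * real d) \<le> 1 / 8"
  shows "measure_pmf.prob (exam_result_graph n m d u) {D. \<not> condition_A n m D}
    \<le> 4 * (exp (1 / real (n + m)) - 1) + 2 / (real (n + m))\<^sup>2"
proof -
  define N where "N = real (n + m)"
  define \<alpha> where "\<alpha> = merit_spread n m u"
  define q where "q = exp (- \<alpha>) / 2"
  define z where "z = exp (- (q * d * n / (2 * m)))"
  have N: "N \<ge> 2" using nm by (simp add: N_def)
  \<comment> \<open>Comparing a vertex with itself gives a nonnegative spread, so
    \<open>1 + exp \<alpha> \<le> 2 * exp \<alpha>\<close>; this is the origin of the factor
    \<open>1 / 2\<close> in \<open>q\<close>.\<close>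
  have "1 \<in> vertices n m" using nm by (simp add: vertices_def left_vertices_def)
  then have "\<alpha> \<ge> 0" using merit_spread_ge[of 1 n m 1 u] by (simp add: \<alpha>_def)
  then have "1 + exp \<alpha> \<le> 2 * exp \<alpha>" by simp
  then have "q \<le> logistic (- \<alpha>)"
    unfolding q_def logistic_def by (simp add: exp_minus divide_simps add_pos_pos)
  then have "measure_pmf.prob (exam_result_graph n m d u) {D. \<not> condition_A n m D}
      \<le> 4 * ((1 + z) ^ (n + m) - 1) + 2 * z"
    unfolding z_def using d nm by (intro prob_not_condition_A_le) (auto simp: q_def \<alpha>_def)
  moreover have z_le: "z \<le> 1 / N\<^sup>2"
  proof -
    have inv: "exp (- \<alpha>) * (8 * exp \<alpha> * N * ln N) = 8 * N * ln N"
      by (simp add: exp_minus)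
    have "8 * exp \<alpha> * N * ln N \<le> n * real d"
      using ratio nm d by (simp add: N_def \<alpha>_def divide_le_eq mult_ac)
    then have "exp (- \<alpha>) * (8 * exp \<alpha> * N * ln N) \<le> exp (- \<alpha>) * (n * real d)"
      by (intro mult_left_mono) auto
    then have "8 * N * ln N \<le> exp (- \<alpha>) * (n * real d)"
      by (simp only: inv)
    moreover have "8 * m * ln N \<le> 8 * N * ln N"
      using N by (intro mult_right_mono) (auto simp: N_def)
    ultimately have "8 * m * ln N \<le> exp (- \<alpha>) * (n * real d)" by linarith
    then have "2 * ln N \<le> q * d * n / (2 * m)"
      using nm by (simp add: q_def field_simps)
    then have "z \<le> exp (- (2 * ln N))" by (simp add: z_def)
    also have "\<dots> = 1 / N\<^sup>2"
      using N by (simp add: exp_minus exp_double divide_simps)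
    finally show ?thesis .
  qed
  \<comment> \<open>The square in \<open>z \<le> 1 / N\<^sup>2\<close> pays off here:
    \<open>N * z\<close> is still at most \<open>1 / N\<close>.\<close>
  moreover have "(1 + z) ^ (n + m) \<le> exp (1 / N)"
  proof -
    have "(1 + z) ^ (n + m) \<le> exp z ^ (n + m)"
      by (intro power_mono) (auto simp: z_def)
    also have "\<dots> = exp (N * z)" by (simp add: exp_of_nat_mult[symmetric] N_def)
    also have "\<dots> \<le> exp (1 / N)"
      using mult_left_mono[OF z_le, of N] N by (simp add: power2_eq_square)
    finally show ?thesis .
  qed
  ultimately show ?thesis by (simp add: N_def)
qed

theorem theorem10:
  fixes n m :: "nat \<Rightarrow> nat"
    and d :: "nat \<Rightarrow> nat \<Rightarrow> nat"
    and u :: "nat \<Rightarrow> nat \<Rightarrow> nat \<Rightarrow> real"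
  assumes "\<And>k. n k \<le> m k"
    and "filterlim n at_top sequentially"
    and "filterlim m at_top sequentially"
    and "\<And>k. 1 \<le> d (n k) (m k) \<and> d (n k) (m k) \<le> m k"
    and "(\<lambda>k. exp (merit_spread (n k) (m k) (u (n k) (m k)))
            * real (n k + m k) * ln (real (n k + m k))
            / (real (n k) * real (d (n k) (m k)))) \<longlonglongrightarrow> 0"
  shows "(\<lambda>k. measure_pmf.prob
            (exam_result_graph (n k) (m k) (d (n k) (m k)) (u (n k) (m k)))
            {D. condition_A (n k) (m k) D}) \<longlonglongrightarrow> 1"
proof -
  let ?M = "\<lambda>k. exam_result_graph (n k) (m k) (d (n k) (m k)) (u (n k) (m k))"
  let ?N = "\<lambda>k. real (n k + m k)"
  let ?b = "\<lambda>x::real. 1 - (4 * (exp (1 / x) - 1) + 2 / x\<^sup>2)"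
  have "filterlim (\<lambda>k. n k + m k) at_top sequentially"
    using assms(2) by (rule filterlim_at_top_mono) auto
  then have N: "filterlim ?N at_top sequentially"
    by (rule filterlim_compose[OF filterlim_real_sequentially])
  \<comment> \<open>The lower bound depends on the total number of vertices alone, so its limit is a
    one-variable computation, composed with \<open>?N\<close>.\<close>
  have "(?b \<longlongrightarrow> 1) at_top" by real_asymp
  then have lower: "(\<lambda>k. ?b (?N k)) \<longlonglongrightarrow> 1" using N by (rule filterlim_compose)
  have "eventually (\<lambda>k. n k \<ge> 1) sequentially"
    using assms(2) by (simp add: filterlim_at_top)
  moreover have "eventually (\<lambda>k. exp (merit_spread (n k) (m k) (u (n k) (m k)))
            * real (n k + m k) * ln (real (n k + m k))
            / (real (n k) * real (d (n k) (m k))) < 1 / 8) sequentially"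
    using assms(5) by (rule order_tendstoD) simp
  ultimately have "eventually (\<lambda>k. ?b (?N k) \<le> measure_pmf.prob (?M k) {D. condition_A (n k) (m k) D}) sequentially"
  proof eventually_elim
    case (elim k)
    have "measure_pmf.prob (?M k) {D. \<not> condition_A (n k) (m k) D}
        = 1 - measure_pmf.prob (?M k) {D. condition_A (n k) (m k) D}"
      using measure_pmf.prob_compl[of "{D. condition_A (n k) (m k) D}" "?M k"]
      by (simp add: Compl_eq_Diff_UNIV[symmetric] Collect_neg_eq[symmetric])
    moreover have "measure_pmf.prob (?M k) {D. \<not> condition_A (n k) (m k) D}
        \<le> 4 * (exp (1 / ?N k) - 1) + 2 / (?N k)\<^sup>2"
      using elim assms(1,4) by (intro prob_not_condition_A_le_of_ratio) auto
    ultimately show ?case by linarith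
  qed
  then show ?thesis
    by (intro tendsto_sandwich[OF _ _ lower tendsto_const]) auto
qed

end
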